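(* For every integer $m\ge2$ we have $F_m(x)\le m\,\omega_m(x)$ for all $x\in[0,1]$, and $F_m=m\,\omega_m$ on $[0,1]$ holds if and only if $m\in\{2,3,4\}$.
   Context: For an integer $m\ge2$, $\mathcal F_m$ is the class of all functions $f:[0,1]\to\mathbb R$ such that $\max\{f(0),f(1)\}\le0$ and such that for all $x_1,\dots,x_m\in[0,1]$ with $\min_ix_i=x_1$ and $\max_ix_i=x_m$, $f\big(\frac{x_1+\dots+x_m}{m}\big)\le\frac{f(x_1)+\dots+f(x_m)}{m}+(x_m-x_1)$. $F_m:[0,1]\to\mathbb R$ denotes the pointwise maximal element of $\mathcal F_m$, i.e. $F_m(x)=\sup\{f(x): f\in\mathcal F_m\}$ (this function belongs to $\mathcal F_m$). For real $x$, $\|x\|$ is the distance from $x$ to the nearest integer, $\|x\|_{\alpha}:=\min\{\|x\|,\alpha\}$, and $\omega_m(x):=\sum_{k=0}^\infty m^{-k}\|m^kx\|_{1/m}$.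
   Formalization: The class F_m is restricted to functions bounded above on [0,1]; without this, discontinuous additive functions vanishing at 1 belong to the class and make the supremum infinite at every irrational point, so F_m would not be real-valued. *)

theory Defs
  imports "HOL-Analysis.Analysis"
begin

text \<open>Functions on the unit interval are total functions on the reals of which only the
  values on \<open>{0..1}\<close> matter.\<close>

definition relaxed_convex :: "nat \<Rightarrow> (real \<Rightarrow> real) \<Rightarrow> bool" where
  "relaxed_convex m f \<longleftrightarrow>
     max (f 0) (f 1) \<le> 0 \<and>
     (\<forall>x::nat \<Rightarrow> real.
        x ` {1..m} \<subseteq> {0..1} \<longrightarrow> Min (x ` {1..m}) = x 1 \<longrightarrow> Max (x ` {1..m}) = x m \<longrightarrow>
        f ((\<Sum>i=1..m. x i) / real m) \<le> (\<Sum>i=1..m. f (x i)) / real m + (x m - x 1))"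

text \<open>Without a regularity assumption the class has no pointwise largest element: an additive
  function vanishing on the rationals satisfies both conditions and may take any prescribed
  value at a given irrational point. This is why boundedness from above is part of the
  definition of \<open>F_class\<close> below.\<close>

lemma relaxed_convex_arbitrary_value:
  fixes y c :: real
  assumes y: "y \<notin> \<rat>"
  shows "\<exists>f. (\<forall>m\<ge>1. relaxed_convex m f) \<and> f y = c"
proof -
  let ?s = "\<lambda>(q::rat) (x::real). of_rat q * x"
  interpret V: vector_space ?s
    by unfold_locales (simp_all add: of_rat_add of_rat_mult algebra_simps)
  interpret VP: vector_space_pair ?s ?s
    by unfold_locales
  have "V.span {1} \<subseteq> \<rat>"
    by (auto simp: V.span_singleton)
  hence ynot: "y \<notin> V.span {1}"
    using y by blast
  have "V.independent (insert y {1})"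
    using ynot V.independent_empty V.independent_insert V.span_empty by auto
  then obtain g where lin: "Vector_Spaces.linear ?s ?s g"
    and g: "\<forall>x\<in>insert y {1}. g x = (if x = y then c else 0)"
    using VP.linear_independent_extend[of _ "\<lambda>x. if x = y then c else 0"] by blast
  have "(1::real) \<noteq> y" using y by auto
  hence g1: "g 1 = 0" and gy: "g y = c" using g by auto
  interpret G: Vector_Spaces.linear ?s ?s g by (rule lin)
  have g0: "g 0 = 0" by (rule G.zero)
  have div: "g (x / real m) = g x / real m" for x m
    using G.scale[of "1 / of_nat m" x] by (simp add: of_rat_divide)
  have "relaxed_convex m g" if "m \<ge> 1" for m
    unfolding relaxed_convex_def
  proof (intro conjI allI impI)
    show "max (g 0) (g 1) \<le> 0" using g0 g1 by simp
  next
    fix x :: "nat \<Rightarrow> real"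
    assume mn: "Min (x ` {1..m}) = x 1"
    have "x 1 \<le> x m" using that mn Min_le[of "x ` {1..m}" "x m"] by auto
    thus "g ((\<Sum>i=1..m. x i) / real m) \<le> (\<Sum>i=1..m. g (x i)) / real m + (x m - x 1)"
      by (simp add: div G.sum)
  qed
  thus ?thesis using gy by blast
qed

definition F_class :: "nat \<Rightarrow> (real \<Rightarrow> real) set" where
  "F_class m = {f. relaxed_convex m f \<and> bdd_above (f ` {0..1})}"

definition F_max :: "nat \<Rightarrow> real \<Rightarrow> real" where
  "F_max m x = (SUP f\<in>F_class m. f x)"

definition dist_int_trunc :: "real \<Rightarrow> real \<Rightarrow> real" where
  "dist_int_trunc \<alpha> x = min (infdist x \<int>) \<alpha>"

definition omega :: "nat \<Rightarrow> real \<Rightarrow> real" where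
  "omega m x = (\<Sum>k. (1 / real m ^ k) * dist_int_trunc (1 / real m) (real m ^ k * x))"

end

theory Submission
  imports Defs
begin

text \<open>Write \<open>G = m \<omega>\<^sub>m\<close> and \<open>\<phi> = m \<parallel>\<cdot>\<parallel>\<close> truncated at \<open>1\<close> (below: \<open>takagi m\<close>, \<open>trap m\<close>), so that
  \<open>G x = \<phi> x + G (m x) / m\<close>. Writing \<open>x\<close> as the mean of zeros, ones and the fractional part of
  \<open>m x\<close> shows \<open>f x \<le> \<phi> x + f (frac (m x)) / m\<close> for every admissible \<open>f\<close>, and iterating
  gives \<open>f \<le> G\<close>. Hence equality holds iff \<open>G\<close> itself is admissible.

  For \<open>m \<ge> 5\<close> it is not: \<open>m - 3\<close> copies of \<open>(m - 2) / m\<^sup>2\<close> and three copies of \<open>2 / m\<close> violate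
  the inequality. For \<open>m \<le> 4\<close> suppose that \<open>G\<close> satisfies the inequality on all of \<open>\<real>\<close> up to
  an error \<open>c\<close>. Since \<open>G\<close> is even, periodic and subadditive, a tuple may be replaced by another
  one in which entries are shifted by integers or merged into their sum plus zeros, without
  increasing the right-hand side. For each tuple in the unit interval, \<open>\<phi>\<close> loses at most what
  such a replacement of the tuple scaled by \<open>m\<close> gains in its spread; the functional equation
  then improves the error to \<open>c / m\<close>, and iterating makes it vanish.\<close>

section \<open>The truncated distance to the integers\<close>

lemma infdist_Ints_le: "infdist x \<int> \<le> \<bar>x - of_int k\<bar>" for x :: real
  using infdist_le[of "of_int k" "\<int>" x] by (simp add: dist_real_def)

lemma infdist_Ints_attained:
  fixes x :: real
  obtains k :: int where "infdist x \<int> = \<bar>x - of_int k\<bar>"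
proof -
  obtain y where "y \<in> (\<int>::real set)" "infdist x \<int> = dist x y"
    using infdist_attains_inf[of "\<int>" x] closed_Ints[where 'a = real]
    by (metis Ints_0 empty_iff)
  thus ?thesis using that by (auto simp: dist_real_def elim: Ints_cases)
qed

lemma infdist_Ints_unit:
  assumes "0 \<le> x" "x \<le> (1::real)"
  shows "infdist x \<int> = min x (1 - x)"
proof -
  obtain k :: int where k: "infdist x \<int> = \<bar>x - of_int k\<bar>"
    by (rule infdist_Ints_attained)
  have "k \<le> 0 \<or> 1 \<le> k" by linarith
  hence "real_of_int k \<le> 0 \<or> 1 \<le> real_of_int k" by auto
  thus ?thesis
    using infdist_Ints_le[of x 0] infdist_Ints_le[of x 1] k assms by auto
qed

lemma infdist_Ints_add_le:
  fixes x y :: real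
  shows "infdist (x + y) \<int> \<le> infdist x \<int> + infdist y \<int>"
proof -
  obtain k l :: int
    where "infdist x \<int> = \<bar>x - of_int k\<bar>" "infdist y \<int> = \<bar>y - of_int l\<bar>"
    by (metis infdist_Ints_attained)
  thus ?thesis using infdist_Ints_le[of "x + y" "k + l"] by simp
qed

lemma infdist_Ints_add_int: "infdist (x + of_int k) \<int> = infdist x \<int>" for x :: real
proof -
  have "infdist (of_int j) (\<int>::real set) = 0" for j :: int by simp
  from this[of k] this[of "- k"] show ?thesis
    using infdist_Ints_add_le[of x "of_int k"]
          infdist_Ints_add_le[of "x + of_int k" "of_int (- k)"] by simp
qed

lemma infdist_Ints_minus: "infdist (- x) \<int> = infdist x \<int>" for x :: real
proof -
  have "infdist (- x) \<int> \<le> infdist x \<int>" for x :: real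
  proof -
    obtain k :: int where "infdist x \<int> = \<bar>x - of_int k\<bar>"
      by (rule infdist_Ints_attained)
    thus ?thesis using infdist_Ints_le[of "- x" "- k"] by simp
  qed
  from this[of x] this[of "- x"] show ?thesis by simp
qed

section \<open>The truncated distance rescaled to height 1\<close>

definition trap :: "nat \<Rightarrow> real \<Rightarrow> real" where
  "trap m x = real m * dist_int_trunc (1 / real m) x"

lemma trap_eq: "m > 0 \<Longrightarrow> trap m x = min (real m * infdist x \<int>) 1"
  by (simp add: trap_def dist_int_trunc_def min_mult_distrib_left)

lemma trap_nonneg: "0 \<le> trap m x"
  by (simp add: trap_def dist_int_trunc_def infdist_nonneg)

lemma trap_le_1: "m > 0 \<Longrightarrow> trap m x \<le> 1"
  by (simp add: trap_eq)

lemma trap_unit: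
  "\<lbrakk>m > 0; 0 \<le> x; x \<le> 1\<rbrakk> \<Longrightarrow> trap m x = min (min (real m * x) (real m - real m * x)) 1"
  by (simp add: trap_eq infdist_Ints_unit min_mult_distrib_left algebra_simps)

lemma trap_le_dist:
  assumes "m > 0"
  shows "trap m x \<le> \<bar>real m * x - real m * of_int k\<bar>"
proof -
  have "real m * infdist x \<int> \<le> real m * \<bar>x - of_int k\<bar>"
    using infdist_Ints_le by (simp add: mult_left_mono)
  thus ?thesis using assms by (simp add: trap_eq abs_mult min.coboundedI1 flip: right_diff_distrib)
qed

lemma trap_add_int: "trap m (x + of_int k) = trap m x"
  by (simp add: trap_def dist_int_trunc_def infdist_Ints_add_int)

lemma trap_minus: "trap m (- x) = trap m x"
  by (simp add: trap_def dist_int_trunc_def infdist_Ints_minus)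

lemma trap_add_le:
  assumes "m > 0"
  shows "trap m (x + y) \<le> trap m x + trap m y"
proof -
  have "real m * infdist (x + y) \<int> \<le> real m * infdist x \<int> + real m * infdist y \<int>"
    using infdist_Ints_add_le[of x y] by (simp add: mult_left_mono flip: distrib_left)
  moreover have "0 \<le> real m * infdist x \<int>" "0 \<le> real m * infdist y \<int>"
    by (simp_all add: infdist_nonneg)
  ultimately show ?thesis using assms by (auto simp: trap_eq)
qed

section \<open>The series and its functional equation\<close>

definition takagi :: "nat \<Rightarrow> real \<Rightarrow> real" where
  "takagi m x = real m * omega m x"

text \<open>The factor \<open>m\<close> turns the truncation height 1/m into 1, so the series is
  dominated by the geometric series of ratio 1/m.\<close>

lemma takagi_eq_suminf:
  assumes "m \<ge> 2"
  shows "summable (\<lambda>k. trap m (real m ^ k * x) / real m ^ k)"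
    and "takagi m x = (\<Sum>k. trap m (real m ^ k * x) / real m ^ k)"
proof -
  show s: "summable (\<lambda>k. trap m (real m ^ k * x) / real m ^ k)"
  proof (rule summable_comparison_test)
    show "\<exists>N. \<forall>k\<ge>N. norm (trap m (real m ^ k * x) / real m ^ k) \<le> (1 / real m) ^ k"
      using assms by (auto simp: trap_nonneg trap_le_1 power_one_over divide_right_mono)
    show "summable (\<lambda>k. (1 / real m) ^ k)" using assms by (simp add: summable_geometric)
  qed
  have eq: "1 / real m ^ k * dist_int_trunc (1 / real m) (real m ^ k * x)
      = (trap m (real m ^ k * x) / real m ^ k) / real m" for k
    using assms by (simp add: trap_def)
  show "takagi m x = (\<Sum>k. trap m (real m ^ k * x) / real m ^ k)"
    unfolding takagi_def omega_def eq suminf_divide[OF s] using assms by simp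
qed

lemma takagi_rec:
  assumes "m \<ge> 2"
  shows "takagi m x = trap m x + takagi m (real m * x) / real m"
proof -
  note s = takagi_eq_suminf[OF assms]
  have "(\<Sum>k. trap m (real m ^ Suc k * x) / real m ^ Suc k)
      = (\<Sum>k. (trap m (real m ^ k * (real m * x)) / real m ^ k) / real m)"
    by (simp add: mult_ac)
  also have "\<dots> = takagi m (real m * x) / real m"
    unfolding s(2)[of "real m * x"] by (rule suminf_divide[OF s(1)])
  finally show ?thesis
    using suminf_split_head[OF s(1)[of x]] s(2)[of x] by simp
qed

text \<open>Comparison with ratio 1/2 gives a bound that does not depend on \<open>m\<close>. Both
  bounds are needed to start the iteration in \<open>jensen_0\<close>; the upper one also gives
  boundedness in \<open>F_class\<close>.\<close>

lemma takagi_bounds: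
  assumes "m \<ge> 2"
  shows "0 \<le> takagi m x" "takagi m x \<le> 2"
proof -
  note s = takagi_eq_suminf[OF assms, of x]
  show "0 \<le> takagi m x"
    unfolding s(2) using s(1) by (intro suminf_nonneg) (simp_all add: trap_nonneg)
  have "takagi m x \<le> (\<Sum>k. (1 / 2 :: real) ^ k)"
    unfolding s(2)
  proof (rule suminf_le[OF _ s(1)])
    fix k
    have "trap m (real m ^ k * x) / real m ^ k \<le> 1 / 2 ^ k"
      using assms by (intro frac_le) (simp_all add: trap_le_1 power_mono)
    thus "trap m (real m ^ k * x) / real m ^ k \<le> (1 / 2) ^ k"
      by (simp add: power_one_over)
  qed (simp add: summable_geometric)
  thus "takagi m x \<le> 2" by (simp add: suminf_geometric)
qed

lemma takagi_add_int:
  assumes "m \<ge> 2"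
  shows "takagi m (x + of_int k) = takagi m x"
proof -
  have "trap m (real m ^ j * (x + of_int k)) = trap m (real m ^ j * x)" for j
    using trap_add_int[of m "real m ^ j * x" "int m ^ j * k"] by (simp add: distrib_left)
  thus ?thesis by (simp add: takagi_eq_suminf[OF assms])
qed

lemma takagi_minus: "m \<ge> 2 \<Longrightarrow> takagi m (- x) = takagi m x"
  by (simp add: takagi_eq_suminf trap_minus)

lemma takagi_add_le:
  assumes "m \<ge> 2"
  shows "takagi m (x + y) \<le> takagi m x + takagi m y"
proof -
  note s = takagi_eq_suminf[OF assms]
  have "trap m (real m ^ k * (x + y)) / real m ^ k
      \<le> trap m (real m ^ k * x) / real m ^ k + trap m (real m ^ k * y) / real m ^ k" for k
    using trap_add_le[of m "real m ^ k * x" "real m ^ k * y"] assms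
    by (simp add: distrib_left divide_right_mono flip: add_divide_distrib)
  thus ?thesis
    unfolding s(2) suminf_add[OF s(1) s(1)]
    by (intro suminf_le summable_add s(1)) auto
qed

lemma takagi_0: "m \<ge> 2 \<Longrightarrow> takagi m 0 = 0"
  by (simp add: takagi_eq_suminf trap_eq)

lemma takagi_int: "m \<ge> 2 \<Longrightarrow> takagi m (of_int k) = 0"
  using takagi_add_int[of m 0 k] by (simp add: takagi_0)

section \<open>The upper bound\<close>

lemma relaxed_convexD:
  assumes "relaxed_convex m f" "m \<ge> 1" "\<And>i. i \<in> {1..m} \<Longrightarrow> 0 \<le> x i \<and> x i \<le> 1"
    "\<And>i. i \<in> {1..m} \<Longrightarrow> x 1 \<le> x i \<and> x i \<le> x m"
  shows "f ((\<Sum>i=1..m. x i) / real m) \<le> (\<Sum>i=1..m. f (x i)) / real m + (x m - x 1)"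
proof -
  have "Min (x ` {1..m}) = x 1" by (rule Min_eqI) (use assms in auto)
  moreover have "Max (x ` {1..m}) = x m" by (rule Max_eqI) (use assms in auto)
  moreover have "x ` {1..m} \<subseteq> {0..1}" using assms(3) by auto
  ultimately show ?thesis using assms(1) unfolding relaxed_convex_def by blast
qed

text \<open>The mean is taken over \<open>j\<close> ones, \<open>m - j - 1\<close> zeros and the fractional part \<open>m x - j\<close>.\<close>

lemma relaxed_convex_step:
  assumes f: "relaxed_convex m f" and m: "m \<ge> 2" and x: "0 \<le> x" "x \<le> 1"
  obtains j :: int where "0 \<le> real m * x - of_int j" "real m * x - of_int j \<le> 1"
    "f x \<le> trap m x + f (real m * x - of_int j) / real m"
proof -
  \<comment> \<open>At \<open>x = 1\<close> the floor would be \<open>m\<close>, leaving no room for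
    the fractional entry; there \<open>j = m - 1\<close> and \<open>t = 1\<close>.\<close>
  define j where "j = (if x = 1 then m - 1 else nat \<lfloor>real m * x\<rfloor>)"
  define t where "t = real m * x - real j"
  have jm: "j < m" and t: "0 \<le> t" "t \<le> 1"
  proof -
    have "real m * x < real m" if "x \<noteq> 1" using that x m by simp
    moreover have "0 \<le> real m * x" using x by simp
    ultimately show "j < m" unfolding j_def using m by (auto simp: nat_less_iff floor_less_iff)
    show "0 \<le> t" "t \<le> 1" unfolding t_def j_def
      using m x \<open>0 \<le> real m * x\<close> by auto linarith+
  qed
  have f01: "f 0 \<le> 0" "f 1 \<le> 0" using f by (auto simp: relaxed_convex_def)
  \<comment> \<open>The tuple 0, ..., 0, t, 1, ..., 1 in increasing order, so its first and last
    entries are the extremes.\<close>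
  define u :: "nat \<Rightarrow> real" where
    "u i = (if j = m - 1 then (if i = 1 then t else 1)
            else if i \<le> m - 1 - j then 0 else if i = m - j then t else 1)" for i
  \<comment> \<open>A general \<open>h\<close> serves twice: the identity computes the mean, and
    \<open>f\<close> computes the right-hand side.\<close>
  have split: "(\<Sum>i=1..m. h (u i)) = real (m - 1 - j) * h 0 + h t + real j * h 1"
    for h :: "real \<Rightarrow> real"
  proof -
    have a: "{1..m} = {1..m - 1 - j} \<union> ({m - j} \<union> {m - j + 1..m})" using jm m by auto
    have "(\<Sum>i=1..m. h (u i)) = (\<Sum>i\<in>{1..m - 1 - j}. h (u i))
        + (h (u (m - j)) + (\<Sum>i\<in>{m - j + 1..m}. h (u i)))"
      by (subst a, subst sum.union_disjoint, (use jm in auto)[3],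
          subst sum.union_disjoint, auto)
    also have "(\<Sum>i\<in>{1..m - 1 - j}. h (u i)) = (\<Sum>i\<in>{1..m - 1 - j}. h 0)"
      by (rule sum.cong) (auto simp: u_def)
    also have "(\<Sum>i\<in>{m - j + 1..m}. h (u i)) = (\<Sum>i\<in>{m - j + 1..m}. h 1)"
      by (rule sum.cong) (use jm in \<open>auto simp: u_def\<close>)
    also have "u (m - j) = t" using jm by (auto simp: u_def)
    finally show ?thesis using jm by simp
  qed
  have mean: "(\<Sum>i=1..m. u i) / real m = x"
    using split[of "\<lambda>x. x"] m by (simp add: t_def)
  have "f ((\<Sum>i=1..m. u i) / real m) \<le> (\<Sum>i=1..m. f (u i)) / real m + (u m - u 1)"
    by (rule relaxed_convexD[OF f]) (use m t jm in \<open>auto simp: u_def\<close>)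
  also have "(\<Sum>i=1..m. f (u i)) \<le> f t"
    unfolding split using f01 by (simp add: mult_nonneg_nonpos add_nonpos_nonpos add.commute
      add_increasing2)
  finally have "f x \<le> f t / real m + (u m - u 1)" using m mean by (simp add: divide_right_mono)
  \<comment> \<open>The three pieces of the trapezoid: without ones the spread is
    \<open>t = m x\<close>, without zeros it is \<open>1 - t = m - m x\<close>, and with both it is
    1 while \<open>m x\<close> lies between 1 and \<open>m - 1\<close>.\<close>
  moreover have "u m - u 1 \<le> trap m x"
  proof -
    have tr: "trap m x = min (min (real m * x) (real m - real m * x)) 1"
        using x m by (intro trap_unit) auto
    consider "j = 0" | "j = m - 1" "j \<noteq> 0" | "j \<noteq> 0" "j \<noteq> m - 1" by blast
    thus ?thesis
    proof cases
      case 1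
      hence "u m = t" "u 1 = 0" using m by (auto simp: u_def)
      moreover have "real m * x = t" using 1 by (simp add: t_def)
      moreover have "t \<le> real m - t" using t m by linarith
      ultimately show ?thesis using t unfolding tr by auto
    next
      case 2
      hence "u m = 1" "u 1 = t" "real j = real m - 1" using m by (auto simp: u_def)
      moreover have "real m - real m * x = 1 - t" "1 - t \<le> real m * x"
        using \<open>real j = real m - 1\<close> t m unfolding t_def by linarith+
      ultimately show ?thesis using t unfolding tr by auto
    next
      case 3
      hence "u m = 1" "u 1 = 0" "1 \<le> real j" "real j \<le> real m - 2"
        using m jm by (auto simp: u_def)
      thus ?thesis using t unfolding tr t_def by auto
    qed
  qed
  ultimately have "f x \<le> trap m x + f t / real m" by linarith
  thus ?thesis using t that[of "int j"] by (simp add: t_def)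
qed

text \<open>After n uses of \<open>relaxed_convex_step\<close> the bound holds up to
  \<open>B / m ^ n\<close>, where \<open>B\<close> comes from boundedness above; then n tends to
  infinity.\<close>

lemma F_class_le_takagi:
  assumes f: "f \<in> F_class m" and m: "m \<ge> 2" and x: "0 \<le> x" "x \<le> 1"
  shows "f x \<le> takagi m x"
proof -
  have rc: "relaxed_convex m f" and "bdd_above (f ` {0..1})"
    using f by (auto simp: F_class_def)
  then obtain B where B: "\<And>x. 0 \<le> x \<Longrightarrow> x \<le> 1 \<Longrightarrow> f x \<le> B"
    unfolding bdd_above_def by (metis atLeastAtMost_iff image_eqI)
  have le: "f x \<le> takagi m x + B / real m ^ n" if "0 \<le> x" "x \<le> 1" for x n
    using that
  proof (induction n arbitrary: x)
    case 0
    thus ?case using B[of x] takagi_bounds(1)[OF m, of x] by simp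
  next
    case (Suc n)
    obtain j :: int where j: "0 \<le> real m * x - of_int j" "real m * x - of_int j \<le> 1"
      "f x \<le> trap m x + f (real m * x - of_int j) / real m"
      by (rule relaxed_convex_step[OF rc m Suc.prems])
    note j(3)
    also have "f (real m * x - of_int j) \<le> takagi m (real m * x) + B / real m ^ n"
      using Suc.IH[OF j(1,2)] takagi_add_int[OF m, of "real m * x" "- j"] by simp
    finally show ?case
      using m takagi_rec[OF m, of x] by (simp add: divide_right_mono add_divide_distrib mult.commute)
  qed
  have "(\<lambda>n. takagi m x + B * (1 / real m) ^ n) \<longlonglongrightarrow> takagi m x + B * 0"
    using m by (intro tendsto_intros LIMSEQ_power_zero) auto
  thus ?thesis
    by (intro LIMSEQ_le_const[of _ "takagi m x" "f x"]) (use le[OF x] in \<open>auto simp: power_one_over\<close>)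
qed

text \<open>Provides nonemptiness, without which the supremum could not be bounded through its
  members.\<close>

lemma zero_in_F_class: "m \<ge> 1 \<Longrightarrow> (\<lambda>x. 0) \<in> F_class m"
proof -
  assume m: "m \<ge> 1"
  have "x 1 \<le> x m" if "Min (x ` {1..m}) = x 1" for x :: "nat \<Rightarrow> real"
    using that m Min_le[of "x ` {1..m}" "x m"] by auto
  thus ?thesis by (auto simp: F_class_def relaxed_convex_def)
qed

lemma F_max_le_takagi:
  assumes "m \<ge> 2" "0 \<le> x" "x \<le> 1"
  shows "F_max m x \<le> takagi m x"
  unfolding F_max_def using zero_in_F_class[of m] assms
  by (intro cSUP_least F_class_le_takagi) auto

lemma F_class_le_F_max:
  assumes "f \<in> F_class m" "m \<ge> 2" "0 \<le> x" "x \<le> 1"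
  shows "f x \<le> F_max m x"
  unfolding F_max_def
  by (rule cSUP_upper[OF assms(1)]) (use F_class_le_takagi assms in \<open>auto simp: bdd_above_def\<close>)

text \<open>For a fixed member the values at the entries are first enlarged to suprema; the
  right-hand side is then independent of the member, and the supremum is taken on the left.\<close>

lemma F_max_convex:
  assumes m: "m \<ge> 2" and u: "\<And>i. i \<in> {1..m} \<Longrightarrow> 0 \<le> x i \<and> x i \<le> 1"
    "\<And>i. i \<in> {1..m} \<Longrightarrow> x 1 \<le> x i \<and> x i \<le> x m"
  shows "F_max m ((\<Sum>i=1..m. x i) / real m)
     \<le> (\<Sum>i=1..m. F_max m (x i)) / real m + (x m - x 1)"
proof -
  have "f ((\<Sum>i=1..m. x i) / real m) \<le> (\<Sum>i=1..m. F_max m (x i)) / real m + (x m - x 1)"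
    if f: "f \<in> F_class m" for f
  proof -
    have "f ((\<Sum>i=1..m. x i) / real m) \<le> (\<Sum>i=1..m. f (x i)) / real m + (x m - x 1)"
      using f by (intro relaxed_convexD) (use m u in \<open>auto simp: F_class_def\<close>)
    also have "(\<Sum>i=1..m. f (x i)) \<le> (\<Sum>i=1..m. F_max m (x i))"
      by (intro sum_mono F_class_le_F_max[OF f m]) (use u in auto)
    finally show ?thesis by (simp add: divide_right_mono)
  qed
  thus ?thesis
    unfolding F_max_def[of m "(\<Sum>i=1..m. x i) / real m"]
    using zero_in_F_class[of m] m by (intro cSUP_least) auto
qed

section \<open>Failure of equality for large parameters\<close>

lemma takagi_not_convex:
  assumes m: "m \<ge> 5"
  shows "\<exists>x\<in>{0..1}. F_max m x \<noteq> takagi m x"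
proof (rule ccontr)
  assume "\<not> ?thesis"
  hence eq: "F_max m x = takagi m x" if "0 \<le> x" "x \<le> 1" for x
    using that by auto
  have m2: "m \<ge> 2" using m by simp
  define r where "r = real m"
  have r: "r \<ge> 5" using m by (simp add: r_def)
  \<comment> \<open>Both are m-adic rationals, so their series break off: \<open>r q = 2\<close> is
    an integer, and \<open>r p = (r - 2) / r\<close> becomes one after one more scaling.\<close>
  define p q where "p = (r - 2) / r\<^sup>2" and "q = 2 / r"
  define u :: "nat \<Rightarrow> real" where "u i = (if i \<le> m - 3 then p else q)" for i
  have split: "(\<Sum>i=1..m. h (u i)) = (r - 3) * h p + 3 * h q" for h :: "real \<Rightarrow> real"
  proof -
    have a: "{1..m} = {1..m - 3} \<union> {m - 2..m}" using m by auto
    have "(\<Sum>i=1..m. h (u i)) = (\<Sum>i\<in>{1..m - 3}. h (u i)) + (\<Sum>i\<in>{m - 2..m}. h (u i))"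
      by (subst a, subst sum.union_disjoint) (use m in auto)
    also have "(\<Sum>i\<in>{1..m - 3}. h (u i)) = (\<Sum>i\<in>{1..m - 3}. h p)"
      by (rule sum.cong) (auto simp: u_def)
    also have "(\<Sum>i\<in>{m - 2..m}. h (u i)) = (\<Sum>i\<in>{m - 2..m}. h q)"
      by (rule sum.cong) (use m in \<open>auto simp: u_def\<close>)
    finally show ?thesis using m by (simp add: r_def)
  qed
  have pq: "0 \<le> p" "p \<le> q" "q \<le> 1"
    using r by (auto simp: p_def q_def field_simps power2_eq_square)
  \<comment> \<open>The mean is chosen so that two scalings stay on the plateau of
    \<open>trap\<close>: \<open>r z\<close> is \<open>(r + 6) / r\<^sup>2\<close> modulo 1, which
    scales to \<open>(r + 6) / r\<close>. Hence G(z) = 1 + 1/r + G((r + 6)/r)/r^2.\<close>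
  define z where "z = (r\<^sup>2 + r + 6) / r ^ 3"
  have mean: "(\<Sum>i=1..m. u i) / r = z"
    using split[of "\<lambda>x. x"] r by (simp add: p_def q_def z_def field_simps power2_eq_square
      power3_eq_cube)
  have trap1: "trap m x = 1" if "1 \<le> r * x" "r * x \<le> r - 1" for x
  proof -
    have "0 \<le> r * x" using that by simp
    have "r * x \<le> r * 1" using that by linarith
    hence "x \<le> 1" by (rule mult_left_le_imp_le) (use r in simp)
    have "0 \<le> x" using \<open>0 \<le> r * x\<close> r by (simp add: zero_le_mult_iff)
    thus ?thesis using that m \<open>x \<le> 1\<close> by (subst trap_unit) (auto simp: r_def)
  qed
  have sq: "5 * r \<le> r * r" using r by (intro mult_right_mono) auto
  have rp: "r * p = (r - 2) / r" and rq: "r * q = 2" and rz: "r * z = (r + 6) / r\<^sup>2 + 1"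
    and rrz: "r * ((r + 6) / r\<^sup>2) = (r + 6) / r"
    using r by (auto simp: p_def q_def z_def field_simps power2_eq_square power3_eq_cube)
  have tq: "takagi m q = 1"
    using takagi_rec[OF m2, of q] takagi_int[OF m2, of 2] trap1[of q] rq r
    by (simp flip: r_def)
  have "takagi m ((r - 2) / r) = 1"
    using takagi_rec[OF m2, of "(r - 2) / r"] takagi_int[OF m2, of "int m - 2"]
      trap1[of "(r - 2) / r"] r by (simp flip: r_def)
  moreover have "trap m p \<le> (r - 2) / r"
    using trap_le_dist[of m p 0] m rp pq r by (simp flip: r_def)
  ultimately have tp: "takagi m p \<le> (r - 1) / r"
    using takagi_rec[OF m2, of p] rp add_divide_distrib[of "r - 2" 1 r] by (simp flip: r_def)
  have "r + 6 \<le> r\<^sup>2" "r + 6 \<le> (r - 1) * r"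
    unfolding power2_eq_square left_diff_distrib using r sq by linarith+
  hence w: "0 \<le> (r + 6) / r\<^sup>2" "(r + 6) / r\<^sup>2 \<le> 1" "1 \<le> (r + 6) / r" "(r + 6) / r \<le> r - 1"
    using r by (simp_all add: pos_divide_le_eq)
  have z: "1 \<le> r * z" "r * z \<le> r - 1" using w r unfolding rz by linarith+
  have "trap m z = 1" by (rule trap1[OF z])
  moreover have "takagi m (r * z) = takagi m ((r + 6) / r\<^sup>2)"
    using takagi_add_int[OF m2, of "(r + 6) / r\<^sup>2" 1] rz by simp
  moreover have "trap m ((r + 6) / r\<^sup>2) = 1"
    using w by (intro trap1) (simp_all only: rrz)
  ultimately have tz: "takagi m z = 1 + (1 + takagi m ((r + 6) / r) / r) / r"
    using takagi_rec[OF m2, of z] takagi_rec[OF m2, of "(r + 6) / r\<^sup>2"] rrz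
    by (simp flip: r_def)
  have "takagi m z \<le> ((r - 3) * takagi m p + 3 * takagi m q) / r + (q - p)"
  proof -
    have "r * z \<le> r * 1" using z by linarith
    hence "z \<le> 1" by (rule mult_left_le_imp_le) (use r in simp)
    moreover have "0 \<le> z" using r by (simp add: z_def)
    moreover have "u m = q" "u 1 = p" using m by (auto simp: u_def)
    moreover have "0 \<le> u i \<and> u i \<le> 1 \<and> p \<le> u i \<and> u i \<le> q" for i
      using pq by (auto simp: u_def)
    moreover have "F_max m p = takagi m p" "F_max m q = takagi m q" using pq eq by auto
    ultimately show ?thesis
      using F_max_convex[of m u] split[of "F_max m"] mean m2 eq[of z] by (simp add: r_def)
  qed
  also have "\<dots> \<le> ((r - 3) * ((r - 1) / r) + 3) / r + (q - p)"
    unfolding tq mult_1_right using tp r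
    by (intro add_right_mono divide_right_mono mult_left_mono) auto
  also have "\<dots> = 1 + 5 / r\<^sup>2"
    using r by (simp add: p_def q_def field_simps power2_eq_square)
  finally have "1 + (1 + takagi m ((r + 6) / r) / r) / r \<le> 1 + 5 / r\<^sup>2" using tz by simp
  moreover have "(1 + takagi m ((r + 6) / r) / r) / r = (r + takagi m ((r + 6) / r)) / r\<^sup>2"
    using r by (simp add: field_simps power2_eq_square)
  ultimately have "(r + takagi m ((r + 6) / r)) / r\<^sup>2 \<le> 5 / r\<^sup>2" by simp
  \<comment> \<open>For r > 5 this already contradicts nonnegativity of \<open>takagi\<close>. For r
    = 5 the last term is G(11/5) = G(1/5) = 1, which breaks the tie.\<close>
  hence le: "r + takagi m ((r + 6) / r) \<le> 5"
    using r by (simp add: divide_le_cancel)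
  hence "r = 5" using r takagi_bounds(1)[OF m2] by (smt (verit))
  hence "m = 5" by (simp add: r_def)
  have "takagi 5 (11 / 5) = takagi 5 (1 / 5)"
    using takagi_add_int[of 5 "1 / 5" 2] by simp
  also have "\<dots> = 1"
    using takagi_rec[of 5 "1 / 5"] takagi_int[of 5 1] by (simp add: trap_unit)
  finally show False using le \<open>r = 5\<close> \<open>m = 5\<close> by simp
qed

section \<open>Equality for small parameters\<close>


lemma sum_mset_le_size_mult:
  fixes M :: "real multiset"
  shows "(\<And>x. x \<in># M \<Longrightarrow> x \<le> hi) \<Longrightarrow> sum_mset M \<le> real (size M) * hi"
  using sum_mset_mono[of M "\<lambda>x. x" "\<lambda>_. hi"] by simp

lemma size_mult_le_sum_mset:
  fixes M :: "real multiset"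
  shows "(\<And>x. x \<in># M \<Longrightarrow> lo \<le> x) \<Longrightarrow> real (size M) * lo \<le> sum_mset M"
  using sum_mset_mono[of M "\<lambda>_. lo" "\<lambda>x. x"] by simp

lemma sum_mset_pos_exists:
  fixes M :: "real multiset"
  assumes "0 \<le> sum_mset M" "a \<in># M" "a < 0"
  obtains b where "b \<in># M" "0 < b"
proof -
  have "\<exists>b\<in>#M. 0 < b"
  proof (rule ccontr)
    assume "\<not> ?thesis"
    hence "x \<le> 0" if "x \<in># M" for x
      using that by force
    hence "sum_mset (M - {#a#}) \<le> real (size (M - {#a#})) * 0"
      by (intro sum_mset_le_size_mult) (auto dest: in_diffD)
    moreover have "sum_mset M = a + sum_mset (M - {#a#})"
      using assms(2) by (metis insert_DiffM sum_mset.add_mset)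
    ultimately show False using assms by simp
  qed
  thus ?thesis using that by blast
qed

lemma sum_mset_affine:
  fixes M :: "real multiset"
  shows "(\<Sum>x\<in>#M. a * x + b) = a * sum_mset M + real (size M) * b"
  by (induction M) (auto simp: algebra_simps)

lemma sorted_multiset:
  fixes M :: "'a::linorder multiset"
  obtains xs where "M = mset xs" "sorted xs" "length xs = size M"
  by (metis mset_sorted_list_of_multiset size_mset sorted_sorted_list_of_multiset)

lemma sorted_multiset_2:
  fixes M :: "'a::linorder multiset"
  assumes "size M = 2"
  obtains a b where "M = {#a, b#}" "a \<le> b"
  by (rule sorted_multiset[of M]) (use assms that in \<open>auto simp: length_Suc_conv numeral_eq_Suc\<close>)

lemma sorted_multiset_3:
  fixes M :: "'a::linorder multiset"
  assumes "size M = 3"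
  obtains a b c where "M = {#a, b, c#}" "a \<le> b" "b \<le> c"
  by (rule sorted_multiset[of M]) (use assms that in \<open>auto simp: length_Suc_conv numeral_eq_Suc\<close>)

lemma sorted_multiset_4:
  fixes M :: "'a::linorder multiset"
  assumes "size M = 4"
  obtains a b c d where "M = {#a, b, c, d#}" "a \<le> b" "b \<le> c" "c \<le> d"
  by (rule sorted_multiset[of M]) (use assms that in \<open>auto simp: length_Suc_conv numeral_eq_Suc\<close>)

text \<open>Collects the symmetries, subadditivity and functional equation of
  \<open>takagi m\<close>. Nonnegativity and boundedness enter later, as hypotheses of
  \<open>jensen_0\<close>.\<close>

locale self_similar =
  fixes m :: nat and g :: "real \<Rightarrow> real"
  assumes m: "m \<ge> 2"
    and minus: "g (- x) = g x"
    and add_int: "g (x + of_int k) = g x"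
    and subadd: "g (x + y) \<le> g x + g y"
    and g_0: "g 0 = 0"
    and rec: "g x = trap m x + g (real m * x) / real m"
begin

text \<open>Tuples are multisets of size \<open>m\<close>, so that their order never matters.\<close>

definition jensen :: "real \<Rightarrow> bool" where
  "jensen c \<longleftrightarrow> (\<forall>M lo hi. size M = m \<longrightarrow> (\<forall>x\<in>#M. lo \<le> x \<and> x \<le> hi) \<longrightarrow>
     g (sum_mset M / m) \<le> (\<Sum>x\<in>#M. g x) / m + (hi - lo) + c)"

lemma jensenD:
  assumes "jensen c" "size M = m" "\<And>x. x \<in># M \<Longrightarrow> lo \<le> x" "\<And>x. x \<in># M \<Longrightarrow> x \<le> hi"
  shows "g (sum_mset M / m) \<le> (\<Sum>x\<in>#M. g x) / m + (hi - lo) + c"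
  using assms unfolding jensen_def by blast

lemma sum_le: "g (sum_mset M) \<le> (\<Sum>x\<in>#M. g x)"
proof (induction M)
  case (add x M)
  thus ?case using subadd[of x "sum_mset M"] by simp
qed (simp add: g_0)

lemma reflect: "g (1 - x) = g x"
  using add_int[of "- x" 1] minus[of x] by (simp add: add.commute)

text \<open>The functional equation at the mean leaves g of the plain sum, which subadditivity
  handles. The two consequences below settle tuples of spread at least 1 and tuples whose mean is
  close to an integer.\<close>

lemma mean_le_trap: "g (sum_mset M / m) \<le> (\<Sum>x\<in>#M. g x) / m + trap m (sum_mset M / m)"
proof -
  have "g (sum_mset M / m) = trap m (sum_mset M / m) + g (sum_mset M) / m"
    using rec[of "sum_mset M / m"] m by simp
  thus ?thesis using sum_le[of M] by (simp add: divide_right_mono)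
qed

lemma mean_le_1: "g (sum_mset M / m) \<le> (\<Sum>x\<in>#M. g x) / m + 1"
  using mean_le_trap[of M] trap_le_1[of m "sum_mset M / m"] m by linarith

lemma mean_le_dist:
  "g (sum_mset M / m) \<le> (\<Sum>x\<in>#M. g x) / m + \<bar>sum_mset M - real m * of_int k\<bar>"
  using mean_le_trap[of M] trap_le_dist[of m "sum_mset M / m" k] m by simp

text \<open>A negative entry is absorbed by a positive one; by subadditivity the sum of the values of
  \<open>g\<close> does not grow.\<close>

lemma cancel_negatives:
  assumes "\<And>x. x \<in># M \<Longrightarrow> x \<le> \<beta>" "0 \<le> sum_mset M"
  obtains N where "size N = size M" "sum_mset N = sum_mset M"
    "(\<Sum>x\<in>#N. g x) \<le> (\<Sum>x\<in>#M. g x)" "\<forall>x\<in>#N. 0 \<le> x \<and> x \<le> \<beta>"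
proof -
  \<comment> \<open>Induction on the number of nonzero entries: replacing \<open>a < 0 < b\<close>
    by \<open>0\<close> and \<open>a + b\<close> lowers it. The nonnegative sum always supplies such
    a \<open>b\<close>, and \<open>a + b < b\<close> preserves the upper bound.\<close>
  have "\<exists>N. size N = size M \<and> sum_mset N = sum_mset M \<and>
    (\<Sum>x\<in>#N. g x) \<le> (\<Sum>x\<in>#M. g x) \<and> (\<forall>x\<in>#N. 0 \<le> x \<and> x \<le> \<beta>)"
    using assms
  proof (induction "size (filter_mset (\<lambda>x. x \<noteq> 0) M)" arbitrary: M rule: less_induct)
    case less
    show ?case
    proof (cases "\<exists>a\<in>#M. a < 0")
      case False
      thus ?thesis using less.prems by (intro exI[of _ M]) auto
    next
      case True
      then obtain a where a: "a \<in># M" "a < 0" by blast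
      obtain b where b: "b \<in># M" "0 < b"
        by (rule sum_mset_pos_exists[OF less.prems(2) a])
      have "b \<in># M - {#a#}" using a b by (auto simp: in_diff_count)
      then obtain K where K: "M = add_mset a (add_mset b K)"
        using a by (metis insert_DiffM)
      let ?N = "add_mset 0 (add_mset (a + b) K)"
      have "size (filter_mset (\<lambda>x. x \<noteq> 0) ?N) < size (filter_mset (\<lambda>x. x \<noteq> 0) M)"
        using a b by (simp add: K)
      moreover have "x \<le> \<beta>" if "x \<in># ?N" for x
        using that less.prems(1)[of x] less.prems(1)[of b] a b by (auto simp: K)
      moreover have "0 \<le> sum_mset ?N" using less.prems(2) by (simp add: K add_ac)
      ultimately obtain N where N: "size N = size ?N" "sum_mset N = sum_mset ?N"
        "(\<Sum>x\<in>#N. g x) \<le> (\<Sum>x\<in>#?N. g x)" "\<forall>x\<in>#N. 0 \<le> x \<and> x \<le> \<beta>"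
        using less.hyps[of ?N] by blast
      have "(\<Sum>x\<in>#?N. g x) \<le> (\<Sum>x\<in>#M. g x)"
        using subadd[of a b] by (simp add: K g_0)
      thus ?thesis using N by (intro exI[of _ N]) (auto simp: K add_ac)
    qed
  qed
  thus ?thesis using that by blast
qed

text \<open>Once the negative entries are absorbed, all entries lie between 0 and
  \<open>\<beta>\<close>, so the lower end of the tuple costs nothing.\<close>

lemma one_sided:
  assumes "jensen c" "size M = m" "\<And>x. x \<in># M \<Longrightarrow> x \<le> \<beta>" "0 \<le> sum_mset M"
  shows "g (sum_mset M / m) \<le> (\<Sum>x\<in>#M. g x) / m + \<beta> + c"
proof -
  obtain N where N: "size N = size M" "sum_mset N = sum_mset M"
    "(\<Sum>x\<in>#N. g x) \<le> (\<Sum>x\<in>#M. g x)" "\<forall>x\<in>#N. 0 \<le> x \<and> x \<le> \<beta>"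
    by (rule cancel_negatives[OF assms(3,4)])
  have "g (sum_mset N / m) \<le> (\<Sum>x\<in>#N. g x) / m + (\<beta> - 0) + c"
    using N assms(1,2) by (intro jensenD) auto
  moreover have "(\<Sum>x\<in>#N. g x) / m \<le> (\<Sum>x\<in>#M. g x) / m"
    using N(3) by (simp add: divide_right_mono)
  ultimately show ?thesis using N(2) by simp
qed

lemma image_sum_mset_1_minus:
  "sum_mset (image_mset (\<lambda>x. 1 - x) M) = real (size M) - sum_mset (M :: real multiset)"
  using sum_mset_affine[of "-1" 1 M] by simp

lemma mean_reflect:
  assumes "size M = m"
  shows "g (sum_mset (image_mset (\<lambda>x. 1 - x) M) / m) = g (sum_mset M / m)"
proof -
  have "sum_mset (image_mset (\<lambda>x. 1 - x) M) / m = 1 - sum_mset M / m"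
    unfolding image_sum_mset_1_minus using assms m by (simp add: field_simps)
  thus ?thesis by (simp add: reflect)
qed

text \<open>An integer shift moves the mean into the unit interval. Spread at least 1 is covered by
  \<open>mean_le_1\<close>; a smaller spread can overshoot only one end of the interval, and
  reflection exchanges the ends.\<close>

lemma jensen_from_unit:
  assumes c: "0 \<le> c" and unit: "\<And>M (lo::real) hi. \<lbrakk>size M = m; 0 \<le> lo; hi \<le> 1; 
      \<And>x. x \<in># M \<Longrightarrow> lo \<le> x; \<And>x. x \<in># M \<Longrightarrow> x \<le> hi\<rbrakk>
     \<Longrightarrow> g (sum_mset M / m) \<le> (\<Sum>x\<in>#M. g x) / m + (hi - lo) + c"
  shows "jensen c"
proof -
  \<comment> \<open>If \<open>lo < 0\<close>, absorbing the negative entries yields a tuple in the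
    unit interval with spread at most \<open>hi\<close>, which is below
    \<open>hi - lo\<close>.\<close>
  have nonneg: "g (sum_mset M / m) \<le> (\<Sum>x\<in>#M. g x) / m + (hi - lo) + c"
    if M: "size M = m" "0 \<le> sum_mset M" "hi \<le> 1" "\<And>x. x \<in># M \<Longrightarrow> lo \<le> x"
      "\<And>x. x \<in># M \<Longrightarrow> x \<le> hi" for M and lo hi :: real
  proof (cases "0 \<le> lo")
    case True
    thus ?thesis using M unit by blast
  next
    case False
    obtain N where N: "size N = size M" "sum_mset N = sum_mset M"
      "(\<Sum>x\<in>#N. g x) \<le> (\<Sum>x\<in>#M. g x)" "\<forall>x\<in>#N. 0 \<le> x \<and> x \<le> hi"
      by (rule cancel_negatives[OF M(5,2)])
    have "g (sum_mset N / m) \<le> (\<Sum>x\<in>#N. g x) / m + (hi - 0) + c"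
      using N M by (intro unit) auto
    moreover have "(\<Sum>x\<in>#N. g x) / m \<le> (\<Sum>x\<in>#M. g x) / m"
      using N(3) by (simp add: divide_right_mono)
    ultimately show ?thesis using N(2) False by simp
  qed
  show ?thesis
    unfolding jensen_def
  proof (intro allI impI)
    fix M and lo hi :: real assume M: "size M = m" "\<forall>x\<in>#M. lo \<le> x \<and> x \<le> hi"
    define k where "k = \<lfloor>sum_mset M / m\<rfloor>"
    define N where "N = image_mset (\<lambda>x. x + of_int (- k)) M"
    have sz: "size N = m" using M by (simp add: N_def)
    have sN: "sum_mset N = sum_mset M - real m * of_int k"
      using sum_mset_affine[of 1 "of_int (- k)" M] M by (simp add: N_def)
    have mean: "sum_mset N / m = sum_mset M / m + of_int (- k)"
      using m by (simp add: sN field_simps)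
    have g: "g (sum_mset N / m) = g (sum_mset M / m)" "(\<Sum>x\<in>#N. g x) = (\<Sum>x\<in>#M. g x)"
      unfolding mean by (simp_all only: add_int N_def image_mset.compositionality o_def)
    have "0 \<le> sum_mset N / m" "sum_mset N / m \<le> 1"
      unfolding mean k_def by linarith+
    hence s: "0 \<le> sum_mset N" "sum_mset N \<le> m" using m by (simp_all add: field_simps)
    define lo' hi' where "lo' = lo - of_int k" and "hi' = hi - of_int k"
    have b: "lo' \<le> x" "x \<le> hi'" if "x \<in># N" for x
      using that M(2) by (auto simp: N_def lo'_def hi'_def)
    consider "1 \<le> hi - lo" | "hi' \<le> 1" | "0 \<le> lo'" "hi - lo < 1"
      unfolding lo'_def hi'_def by linarith
    hence "g (sum_mset N / m) \<le> (\<Sum>x\<in>#N. g x) / m + (hi' - lo') + c"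
    proof cases
      case 1
      thus ?thesis using mean_le_1[of N] c by (simp add: lo'_def hi'_def)
    next
      case 2
      thus ?thesis using nonneg s(1) sz b by blast
    next
      case 3
      let ?R = "image_mset (\<lambda>x. 1 - x) N"
      have "g (sum_mset ?R / m) \<le> (\<Sum>x\<in>#?R. g x) / m + ((1 - lo') - (1 - hi')) + c"
        using 3 b sz s by (intro nonneg) (auto simp: image_sum_mset_1_minus)
      thus ?thesis using mean_reflect[OF sz] by (simp add: image_mset.compositionality o_def reflect)
    qed
    thus "g (sum_mset M / m) \<le> (\<Sum>x\<in>#M. g x) / m + (hi - lo) + c"
      by (simp add: g lo'_def hi'_def)
  qed
qed

text \<open>The functional equation is applied to every entry and to the mean. The scaled tuple has
  mean \<open>sum_mset M\<close>, may use the spread \<open>m d\<close> corrected by the balance of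
  the \<open>trap\<close> terms, and its error \<open>c\<close> returns divided by
  \<open>m\<close>.\<close>

lemma scale:
  assumes M: "size M = m"
    and le: "g (sum_mset M) \<le> (\<Sum>x\<in>#M. g (real m * x)) / m
      + ((\<Sum>x\<in>#M. trap m x) - real m * trap m (sum_mset M / m) + real m * d) + c"
  shows "g (sum_mset M / m) \<le> (\<Sum>x\<in>#M. g x) / m + d + c / m"
proof -
  have "(\<Sum>x\<in>#M. g x) = (\<Sum>x\<in>#M. trap m x + g (real m * x) / m)"
    by (subst rec) simp
  also have "\<dots> = (\<Sum>x\<in>#M. trap m x) + (\<Sum>x\<in>#M. g (real m * x)) / m"
    by (simp add: sum_mset.distrib sum_mset_distrib_right divide_inverse)
  finally have 1: "(\<Sum>x\<in>#M. g x) = (\<Sum>x\<in>#M. trap m x) + (\<Sum>x\<in>#M. g (real m * x)) / m" .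
  have 2: "g (sum_mset M / m) = trap m (sum_mset M / m) + g (sum_mset M) / m"
    using rec[of "sum_mset M / m"] m by simp
  have "g (sum_mset M) / m \<le> ((\<Sum>x\<in>#M. g (real m * x)) / m
      + ((\<Sum>x\<in>#M. trap m x) - real m * trap m (sum_mset M / m) + real m * d) + c) / m"
    using le by (simp add: divide_right_mono)
  also have "\<dots> = (\<Sum>x\<in>#M. g (real m * x)) / m / m + (\<Sum>x\<in>#M. trap m x) / m
      - trap m (sum_mset M / m) + d + c / m"
    using m by (simp add: add_divide_distrib diff_divide_distrib)
  finally show ?thesis unfolding 1 2 by (simp add: add_divide_distrib)
qed


lemma g_minus_int [simp]: "g (x - of_int k) = g x"
  using add_int[of x "- k"] by simp

lemma g_int_minus: "g (of_int k - x) = g x"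
  using g_minus_int[of x k] minus[of "x - of_int k"] by simp

text \<open>Sharpens the inequality by the total of the negative parts, which is what
  \<open>trap\<close> loses on entries off its plateau. If that total is at least \<open>lo\<close>,
  \<open>one_sided\<close> suffices; if the sum is within the allowance, so does the distance of the
  sum to 0.\<close>

lemma mixed_sign:
  assumes m4: "m \<le> 4" and c: "jensen c" "0 \<le> c" and U: "size U = m"
    "\<And>u. u \<in># U \<Longrightarrow> lo \<le> u" "\<And>u. u \<in># U \<Longrightarrow> u \<le> hi" "0 \<le> sum_mset U"
  shows "g (sum_mset U / m) \<le> (\<Sum>u\<in>#U. g u) / m + (hi - lo + (\<Sum>u\<in>#U. min u 0)) + c"
proof -
  consider "0 \<le> lo" | "lo \<le> (\<Sum>u\<in>#U. min u 0)" | "sum_mset U \<le> hi - lo + (\<Sum>u\<in>#U. min u 0)"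
    | "lo < 0" "(\<Sum>u\<in>#U. min u 0) < lo" "hi - lo + (\<Sum>u\<in>#U. min u 0) < sum_mset U"
    by linarith
  thus ?thesis
  proof cases
    case 1
    hence "image_mset (\<lambda>u. min u 0) U = image_mset (\<lambda>_. 0) U"
      using U(2) by (intro image_mset_cong) force
    thus ?thesis using jensenD[OF c(1) U(1,2,3)] by simp
  next
    case 2
    thus ?thesis using one_sided[OF c(1) U(1,3,4)] by simp
  next
    case 3
    thus ?thesis using mean_le_dist[of U 0] U(4) c(2) by simp
  next
    case 4
    \<comment> \<open>The remaining case needs at least two negative and two positive entries, hence
      is contradictory for 2 and 3 entries.\<close>
    consider "m = 2" | "m = 3" | "m = 4" using m m4 by linarith
    thus ?thesis
    proof cases
      case 1
      then obtain a b where "U = {#a, b#}" "a \<le> b"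
        using sorted_multiset_2 U(1) by metis
      thus ?thesis using 4 U(2)[of a] U(2,3)[of b] U(4) by (simp add: min_def split: if_splits)
    next
      case 2
      then obtain a b c where "U = {#a, b, c#}" "a \<le> b" "b \<le> c"
        using sorted_multiset_3 U(1) by metis
      thus ?thesis using 4 U(2)[of a] U(3)[of c] U(4) by (simp add: min_def split: if_splits)
    next
      case 3
      then obtain x y z w where xyzw: "U = {#x, y, z, w#}" "x \<le> y" "y \<le> z" "z \<le> w"
        using sorted_multiset_4 U(1) by metis
      have "y < 0" "0 < z"
        using 4 U(2)[of x] U(3)[of w] U(4) xyzw by (auto simp: min_def split: if_splits)
      \<comment> \<open>Each negative entry is paired with a positive one. The larger pair sum
        \<open>y + w\<close> is nonnegative, and \<open>w \<le> hi\<close>,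
        \<open>lo \<le> x\<close> put it within the allowance.\<close>
      let ?V = "{#x + z, y + w, 0, 0#}"
      have "g (sum_mset ?V / m) \<le> (\<Sum>u\<in>#?V. g u) / m + (y + w) + c"
        using xyzw U(4) by (intro one_sided c) (auto simp: 3)
      moreover have "(\<Sum>u\<in>#?V. g u) / m \<le> (\<Sum>u\<in>#U. g u) / m"
        using subadd[of x z] subadd[of y w] by (simp add: xyzw g_0 divide_right_mono)
      moreover have s: "sum_mset U = sum_mset ?V" by (simp add: xyzw)
      moreover have "y + w \<le> hi - lo + (\<Sum>u\<in>#U. min u 0)"
        using U(2)[of x] U(3)[of w] xyzw \<open>y < 0\<close> \<open>0 < z\<close> by simp
      ultimately show ?thesis unfolding s by linarith
    qed
  qed
qed

lemma scale_le:
  assumes M: "size M = m"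
    and le: "g (sum_mset M) \<le> (\<Sum>x\<in>#M. g (real m * x)) / m + r + c"
    and r: "r \<le> (\<Sum>x\<in>#M. trap m x) - real m * trap m (sum_mset M / m) + real m * d"
  shows "g (sum_mset M / m) \<le> (\<Sum>x\<in>#M. g x) / m + d + c / m"
  using le r by (intro scale[OF M]) linarith

section \<open>The contraction step for tuples in the unit interval\<close>

context
  fixes M :: "real multiset" and lo hi c :: real
  assumes c: "jensen c" "0 \<le> c" and m4: "m \<le> 4"
    and M: "size M = m" "0 \<le> lo" "hi \<le> 1" "\<And>x. x \<in># M \<Longrightarrow> lo \<le> x" "\<And>x. x \<in># M \<Longrightarrow> x \<le> hi"
begin

lemma trap_entry:
  "x \<in># M \<Longrightarrow> trap m x = min (min (real m * x) (real m - real m * x)) 1"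
  using M(2-5) m by (intro trap_unit) force+

lemma unit_range: "0 \<le> sum_mset M" "sum_mset M \<le> m"
  using size_mult_le_sum_mset[of M 0] sum_mset_le_size_mult[of M 1] M by force+

lemma trap_mean: "trap m (sum_mset M / m) = min (min (sum_mset M) (m - sum_mset M)) 1"
  using unit_range m by (subst trap_unit) (auto simp: field_simps)

text \<open>The mean lies on the plateau and no entry lies beyond it, so each entry loses exactly
  the negative part of \<open>m x - 1\<close>. Shifting the scaled tuple by 1 makes these losses the
  correction in \<open>mixed_sign\<close>.\<close>

lemma unit_flat:
  assumes low: "real m * hi \<le> real m - 1" and s: "1 \<le> sum_mset M"
  shows "g (sum_mset M / m) \<le> (\<Sum>x\<in>#M. g x) / m + (hi - lo) + c / m"
proof (rule scale_le[OF M(1)])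
  let ?U = "image_mset (\<lambda>x. real m * x + - 1) M"
  have mx: "real m * lo \<le> real m * x" "real m * x \<le> real m * hi" if "x \<in># M" for x
    using that M(4,5) m by (auto intro: mult_left_mono)
  have sU: "sum_mset ?U = real m * sum_mset M - m"
    using sum_mset_affine[of m "-1" M] M(1) by simp
  have meanU: "sum_mset ?U / m = sum_mset M - of_int 1"
    unfolding sU using m by (simp add: field_simps)
  have "real m * 1 \<le> real m * sum_mset M" using s by (intro mult_left_mono) auto
  hence "0 \<le> sum_mset ?U" unfolding sU by simp
  hence "g (sum_mset ?U / m) \<le> (\<Sum>u\<in>#?U. g u) / m
      + ((real m * hi - 1) - (real m * lo - 1) + (\<Sum>u\<in>#?U. min u 0)) + c"
    using M(1) mx by (intro mixed_sign[OF m4 c]) auto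
  moreover have "(\<Sum>u\<in>#?U. g u) = (\<Sum>x\<in>#M. g (real m * x))"
    using add_int[of _ "- 1"] by (simp add: image_mset.compositionality o_def)
  moreover have "g (sum_mset ?U / m) = g (sum_mset M)" by (simp only: meanU g_minus_int)
  ultimately show "g (sum_mset M) \<le> (\<Sum>x\<in>#M. g (real m * x)) / m
      + ((real m * hi - 1) - (real m * lo - 1) + (\<Sum>u\<in>#?U. min u 0)) + c" by simp
  have "sum_mset M \<le> real m * hi"
    using sum_mset_le_size_mult[of M hi] M by auto
  hence "trap m (sum_mset M / m) = 1" using s low by (simp add: trap_mean)
  moreover have "image_mset (\<lambda>x. trap m x) M = image_mset (\<lambda>x. 1 + min (real m * x + - 1) 0) M"
    using mx low by (intro image_mset_cong) (force simp: trap_entry)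
  ultimately show "real m * hi - 1 - (real m * lo - 1) + (\<Sum>u\<in>#?U. min u 0)
      \<le> (\<Sum>x\<in>#M. trap m x) - real m * trap m (sum_mset M / m) + real m * (hi - lo)"
    using M(1) by (simp add: sum_mset.distrib right_diff_distrib image_mset.compositionality o_def)
qed

text \<open>Here the mean lies on the rising edge. If no entry is beyond the plateau,
  \<open>trap m x\<close> is \<open>m x\<close> plus the negative part of \<open>1 - m x\<close>;
  the linear parts cancel against the mean, and \<open>mixed_sign\<close> applies to the entries
  \<open>1 - m x\<close>.\<close>

lemma unit_left:
  assumes s: "sum_mset M \<le> 1"
  shows "g (sum_mset M / m) \<le> (\<Sum>x\<in>#M. g x) / m + (hi - lo) + c / m"
proof (cases "\<forall>x\<in>#M. real m * x \<le> real m - 1")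
  case True
  show ?thesis
  proof (rule scale_le[OF M(1)])
    let ?U = "image_mset (\<lambda>x. - real m * x + 1) M"
    have mx: "real m * lo \<le> real m * x" "real m * x \<le> real m * hi" if "x \<in># M" for x
      using that M(4,5) m by (auto intro: mult_left_mono)
    have sU: "sum_mset ?U = m - real m * sum_mset M"
      using sum_mset_affine[of "- real m" 1 M] M(1) by simp
    have meanU: "sum_mset ?U / m = of_int 1 - sum_mset M"
      unfolding sU using m by (simp add: field_simps)
    have "real m * sum_mset M \<le> real m * 1" using s by (intro mult_left_mono) auto
    hence "0 \<le> sum_mset ?U" unfolding sU by simp
    hence "g (sum_mset ?U / m) \<le> (\<Sum>u\<in>#?U. g u) / m
        + ((1 - real m * lo) - (1 - real m * hi) + (\<Sum>u\<in>#?U. min u 0)) + c"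
      using M(1) mx by (intro mixed_sign[OF m4 c]) auto
    moreover have "(\<Sum>u\<in>#?U. g u) = (\<Sum>x\<in>#M. g (real m * x))"
      using g_int_minus[of 1] by (simp add: image_mset.compositionality o_def)
    moreover have "g (sum_mset ?U / m) = g (sum_mset M)" by (simp only: meanU g_int_minus)
    ultimately show "g (sum_mset M) \<le> (\<Sum>x\<in>#M. g (real m * x)) / m
        + ((1 - real m * lo) - (1 - real m * hi) + (\<Sum>u\<in>#?U. min u 0)) + c" by simp
    have "trap m (sum_mset M / m) = sum_mset M" using s m by (simp add: trap_mean)
    moreover have "image_mset (\<lambda>x. trap m x) M
        = image_mset (\<lambda>x. min (- real m * x + 1) 0 + real m * x) M"
      using True by (intro image_mset_cong) (force simp: trap_entry)
    moreover have "(\<Sum>x\<in>#M. real m * x) = real m * sum_mset M"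
      using sum_mset_affine[of m 0 M] by simp
    ultimately show "1 - real m * lo - (1 - real m * hi) + (\<Sum>u\<in>#?U. min u 0)
        \<le> (\<Sum>x\<in>#M. trap m x) - real m * trap m (sum_mset M / m) + real m * (hi - lo)"
      by (simp add: sum_mset.distrib right_diff_distrib image_mset.compositionality o_def)
  qed
next
  case False
  \<comment> \<open>An entry beyond the plateau nearly exhausts the sum, so it is unique and all
    others lie on the rising edge. The scaled mean is then close to 1, and
    \<open>mean_le_dist\<close> with \<open>k = 1\<close> is enough.\<close>
  then obtain h where h: "h \<in># M" "real m - 1 < real m * h" by force
  then obtain K where K: "M = add_mset h K" by (metis insert_DiffM)
  have szK: "real (size K) = real m - 1" using M(1) K by auto
  have K0: "0 \<le> x" if "x \<in># K" for x using that M(2) M(4)[of x] K by auto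
  have "real m * (h + sum_mset K) \<le> real m * 1"
    using s K by (intro mult_left_mono) auto
  hence mK: "real m * sum_mset K < 1" using h by (simp add: distrib_left)
  have tK: "trap m x = real m * x" if x: "x \<in># K" for x
  proof -
    have "0 \<le> sum_mset (K - {#x#})"
      using size_mult_le_sum_mset[of "K - {#x#}" 0] K0 by (auto dest: in_diffD)
    hence "x \<le> sum_mset K" using x by (metis insert_DiffM le_add_same_cancel1 sum_mset.add_mset)
    hence "real m * x \<le> real m * sum_mset K" by (intro mult_left_mono) auto
    hence "real m * x < 1" "real m * x \<le> real m - real m * x" using mK m by linarith+
    thus ?thesis using x K by (subst trap_entry) auto
  qed
  have th: "trap m h = m - real m * h" using h m by (simp add: trap_entry)
  have tm: "trap m (sum_mset M / m) = sum_mset M" using s m by (simp add: trap_mean)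
  \<comment> \<open>At least one entry besides \<open>h\<close> exists, so their sum dominates
    \<open>lo\<close>; with \<open>h \<le> hi\<close> this pays for the falling edge at
    \<open>h\<close>.\<close>
  have "lo * 1 \<le> lo * (real m - 1)" using M(2) m by (intro mult_left_mono) auto
  hence "lo \<le> sum_mset K"
    using size_mult_le_sum_mset[of K lo] M(4) K by (auto simp: szK mult.commute)
  hence mlo: "real m * lo \<le> real m * sum_mset K" by (intro mult_left_mono) auto
  have mhi: "real m * h \<le> real m * hi" using M(5)[OF h(1)] by (intro mult_left_mono) auto
  show ?thesis
  proof (rule scale_le[OF M(1)])
    let ?Y = "image_mset (\<lambda>x. real m * x) M"
    have sY: "sum_mset ?Y = real m * sum_mset M"
      using sum_mset_affine[of m 0 M] by simp
    have "sum_mset ?Y / m = sum_mset M" unfolding sY using m by simp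
    hence "g (sum_mset M) \<le> (\<Sum>x\<in>#M. g (real m * x)) / m + \<bar>real m * sum_mset M - real m * of_int 1\<bar>"
      using mean_le_dist[of ?Y 1] by (simp add: sY image_mset.compositionality o_def)
    also have "\<bar>real m * sum_mset M - real m * of_int 1\<bar> = m - real m * sum_mset M"
      using \<open>real m * (h + sum_mset K) \<le> real m * 1\<close> by (simp add: K)
    finally show "g (sum_mset M) \<le> (\<Sum>x\<in>#M. g (real m * x)) / m + (m - real m * sum_mset M) + c"
      using c by simp
    have "image_mset (trap m) K = image_mset (\<lambda>x. real m * x + 0) K"
      using tK by (intro image_mset_cong) simp
    hence "(\<Sum>x\<in>#K. trap m x) = real m * sum_mset K"
      using sum_mset_affine[of m 0 K] by simp
    thus "m - real m * sum_mset M
      \<le> (\<Sum>x\<in>#M. trap m x) - real m * trap m (sum_mset M / m) + real m * (hi - lo)"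
      unfolding tm using mlo mhi by (simp add: K th algebra_simps)
  qed
qed

text \<open>The outer entries lie on opposite edges, and their \<open>trap\<close> values together
  with the spread pay for the mean, leaving \<open>trap m x2\<close>. On the plateau this is 1; on
  an edge, an integer shift or reflection gives a tuple of nonnegative sum whose entries are at most
  \<open>trap m x2\<close>.\<close>

lemma unit_straddle_3:
  assumes m3: "m = 3" and s: "1 \<le> sum_mset M" "sum_mset M \<le> 2"
    and x: "M = {#x1, x2, x3#}" "x1 \<le> x2" "x2 \<le> x3" "3 * x1 < 1" "2 < 3 * x3"
  shows "g (sum_mset M / m) \<le> (\<Sum>x\<in>#M. g x) / m + (hi - lo) + c / m"
proof (rule scale_le[OF M(1)])
  have "x1 \<in># M" "x2 \<in># M" "x3 \<in># M" by (auto simp: x)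
  note t = this[THEN trap_entry, unfolded m3] and b = M(4)[OF this(1)] M(5)[OF this(3)]
  have "trap m (sum_mset M / m) = 1" unfolding trap_mean using s by (simp add: m3)
  thus "trap m x2
      \<le> (\<Sum>x\<in>#M. trap m x) - real m * trap m (sum_mset M / m) + real m * (hi - lo)"
    using x b by (simp add: t m3)
  have y: "g (3 * x3 - 3) = g (3 * x3)" "g (3 - 3 * x3) = g (3 * x3)" "g (3 - 3 * x2) = g (3 * x2)"
    "g (sum_mset M - 1) = g (sum_mset M)" "g (2 - sum_mset M) = g (sum_mset M)"
    using g_minus_int[of _ 3] g_int_minus[of 3] g_minus_int[of _ 1] g_int_minus[of 2]
    by simp_all
  consider "3 * x2 < 1" | "1 \<le> 3 * x2" "3 * x2 \<le> 2" | "2 < 3 * x2" by linarith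
  thus "g (sum_mset M) \<le> (\<Sum>x\<in>#M. g (real m * x)) / m + trap m x2 + c"
  proof cases
    case 1
    let ?V = "{#3 * x1, 3 * x2, 3 * x3 - 3#}"
    have "sum_mset ?V / m = sum_mset M - 1" by (simp add: x m3 field_simps)
    hence e: "g (sum_mset M) = g (sum_mset ?V / m)" by (simp only: y)
    have "g (sum_mset ?V / m) \<le> (\<Sum>x\<in>#?V. g x) / m + 3 * x2 + c"
      using x s M(3) b by (intro one_sided c) (auto simp: m3)
    thus ?thesis unfolding e using 1 y by (simp add: x t m3)
  next
    case 2
    thus ?thesis
      using mean_le_1[of "image_mset (\<lambda>x. 3 * x) M"] c by (simp add: x t m3 add_divide_distrib)
  next
    case 3
    let ?V = "{#3 - 3 * x3, 3 - 3 * x2, - (3 * x1)#}"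
    have "sum_mset ?V / m = 2 - sum_mset M" by (simp add: x m3 field_simps)
    hence e: "g (sum_mset M) = g (sum_mset ?V / m)" by (simp only: y)
    have "g (sum_mset ?V / m) \<le> (\<Sum>x\<in>#?V. g x) / m + (3 - 3 * x2) + c"
      using x s M(2,3) b by (intro one_sided c) (auto simp: m3)
    thus ?thesis unfolding e using 3 y minus[of "3 * x1"] by (simp add: x t m3 add_ac)
  qed
qed

text \<open>As for three entries, the allowance left is now \<open>trap m x2 + trap m x3\<close>.
  One inner entry on the plateau suffices; otherwise both lie on one edge or one on each.\<close>

lemma unit_straddle_4:
  assumes m4: "m = 4" and s: "1 \<le> sum_mset M" "sum_mset M \<le> 3"
    and x: "M = {#x1, x2, x3, x4#}" "x1 \<le> x2" "x2 \<le> x3" "x3 \<le> x4" "4 * x1 < 1" "3 < 4 * x4"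
  shows "g (sum_mset M / m) \<le> (\<Sum>x\<in>#M. g x) / m + (hi - lo) + c / m"
proof (rule scale_le[OF M(1)])
  have "x1 \<in># M" "x2 \<in># M" "x3 \<in># M" "x4 \<in># M" by (auto simp: x)
  note t = this[THEN trap_entry, unfolded m4] and b = M(4)[OF this(1)] M(5)[OF this(4)]
  have "trap m (sum_mset M / m) = 1" unfolding trap_mean using s by (simp add: m4)
  thus "trap m x2 + trap m x3
      \<le> (\<Sum>x\<in>#M. trap m x) - real m * trap m (sum_mset M / m) + real m * (hi - lo)"
    using x b by (simp add: t m4)
  have y: "g (4 * x - 4) = g (4 * x)" "g (4 - 4 * x) = g (4 * x)" "g (- (4 * x)) = g (4 * x)" for x
    using g_minus_int[of _ 4] g_int_minus[of 4] minus[of "4 * x"] by simp_all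
  have gs: "g (sum_mset M - 1) = g (sum_mset M)" "g (sum_mset M - 2) = g (sum_mset M)"
    "g (2 - sum_mset M) = g (sum_mset M)" "g (3 - sum_mset M) = g (sum_mset M)"
    using g_minus_int[of _ 1] g_minus_int[of _ 2] g_int_minus[of 2] g_int_minus[of 3]
    by simp_all
  have le: "g (sum_mset M) \<le> (\<Sum>x\<in>#M. g (real m * x)) / m + trap m x2 + trap m x3 + c"
    if "size V = m" "0 \<le> sum_mset V" "\<And>v. v \<in># V \<Longrightarrow> v \<le> \<beta>" "\<beta> \<le> trap m x2 + trap m x3"
      "g (sum_mset V / m) = g (sum_mset M)" "(\<Sum>v\<in>#V. g v) = (\<Sum>x\<in>#M. g (real m * x))" for V \<beta>
    using one_sided[OF c(1) that(1,3,2)] that(4-6) by simp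
  consider "4 * x3 < 1" | "3 < 4 * x2" | "1 \<le> 4 * x2" "4 * x2 \<le> 3" | "1 \<le> 4 * x3" "4 * x3 \<le> 3"
    | "4 * x2 < 1" "3 < 4 * x3" "2 \<le> sum_mset M" | "4 * x2 < 1" "3 < 4 * x3" "sum_mset M \<le> 2"
    by linarith
  hence "g (sum_mset M) \<le> (\<Sum>x\<in>#M. g (real m * x)) / m + trap m x2 + trap m x3 + c"
  proof cases
    case 1
    let ?V = "{#4 * x1, 4 * x2, 4 * x3, 4 * x4 - 4#}"
    have "sum_mset ?V / m = sum_mset M - 1" by (simp add: x m4 field_simps)
    hence e: "g (sum_mset ?V / m) = g (sum_mset M)" by (simp only: gs)
    show ?thesis
      using 1 x s M(2,3) b by (intro le[of ?V "4 * x3", OF _ _ _ _ e]) (auto simp: m4 t y)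
  next
    case 2
    let ?V = "{#- (4 * x1), 4 - 4 * x2, 4 - 4 * x3, 4 - 4 * x4#}"
    have "sum_mset ?V / m = 3 - sum_mset M" by (simp add: x m4 field_simps)
    hence e: "g (sum_mset ?V / m) = g (sum_mset M)" by (simp only: gs)
    show ?thesis
      using 2 x s M(2,3) b by (intro le[of ?V "4 - 4 * x2", OF _ _ _ _ e]) (auto simp: m4 t y)
  next
    case 3
    thus ?thesis
      using mean_le_1[of "image_mset (\<lambda>x. 4 * x) M"] trap_nonneg[of m x3] c
      by (simp add: x t(2) m4 add_divide_distrib)
  next
    case 4
    thus ?thesis
      using mean_le_1[of "image_mset (\<lambda>x. 4 * x) M"] trap_nonneg[of m x2] c
      by (simp add: x t(3) m4 add_divide_distrib)
  next
    case 5
    \<comment> \<open>With the inner entries on different edges, comparing the sum with 2 decides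
      between this shift and its mirror image: the chosen tuple must have nonnegative sum.\<close>
    let ?V = "{#4 * x1, 4 * x2, 4 * x3 - 4, 4 * x4 - 4#}"
    have "sum_mset ?V / m = sum_mset M - 2" by (simp add: x m4 field_simps)
    hence e: "g (sum_mset ?V / m) = g (sum_mset M)" by (simp only: gs)
    show ?thesis
      using 5 x s M(2,3) b by (intro le[of ?V "4 * x2", OF _ _ _ _ e]) (auto simp: m4 t y)
  next
    case 6
    let ?V = "{#- (4 * x1), - (4 * x2), 4 - 4 * x3, 4 - 4 * x4#}"
    have "sum_mset ?V / m = 2 - sum_mset M" by (simp add: x m4 field_simps)
    hence e: "g (sum_mset ?V / m) = g (sum_mset M)" by (simp only: gs)
    show ?thesis
      using 6 x s M(2,3) b by (intro le[of ?V "4 - 4 * x3", OF _ _ _ _ e]) (auto simp: m4 t y)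
  qed
  thus "g (sum_mset M) \<le> (\<Sum>x\<in>#M. g (real m * x)) / m + (trap m x2 + trap m x3) + c" by simp
qed

end

text \<open>Reflection pairs the cases of small and large sum, and those with no entry beyond either
  end of the plateau. What remains has an entry on each edge while the mean is on the
  plateau.\<close>

lemma jensen_contract:
  assumes c: "jensen c" "0 \<le> c" and m4: "m \<le> 4"
  shows "jensen (c / m)"
proof (rule jensen_from_unit)
  fix M and lo hi :: real
  assume M: "size M = m" "0 \<le> lo" "hi \<le> 1" "\<And>x. x \<in># M \<Longrightarrow> lo \<le> x" "\<And>x. x \<in># M \<Longrightarrow> x \<le> hi"
  let ?R = "image_mset (\<lambda>x. 1 - x) M"
  have reflected: "g (sum_mset M / m) \<le> (\<Sum>x\<in>#M. g x) / m + (hi - lo) + c / m"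
    if "g (sum_mset ?R / m) \<le> (\<Sum>x\<in>#?R. g x) / m + ((1 - lo) - (1 - hi)) + c / m"
    using that mean_reflect[OF M(1)] by (simp add: image_mset.compositionality o_def reflect)
  have R: "size ?R = m" "0 \<le> 1 - hi" "1 - lo \<le> 1" "\<And>x. x \<in># ?R \<Longrightarrow> 1 - hi \<le> x"
    "\<And>x. x \<in># ?R \<Longrightarrow> x \<le> 1 - lo" "sum_mset ?R = m - sum_mset M"
    using M by (auto simp: image_sum_mset_1_minus)
  show "g (sum_mset M / m) \<le> (\<Sum>x\<in>#M. g x) / m + (hi - lo) + c / m"
  proof -
    consider "sum_mset M \<le> 1" | "real m - 1 \<le> sum_mset M"
      | "1 \<le> sum_mset M" "\<forall>x\<in>#M. real m * x \<le> real m - 1"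
      | "sum_mset M \<le> real m - 1" "\<forall>x\<in>#M. 1 \<le> real m * x"
      | a b where "1 < sum_mset M" "sum_mset M < real m - 1"
          "a \<in># M" "b \<in># M" "real m * a < 1" "real m - 1 < real m * b"
      by (meson linorder_not_le less_imp_le)
    thus ?thesis
    proof cases
      case 1
      thus ?thesis using M by (intro unit_left[OF c m4]) auto
    next
      case 2
      thus ?thesis using R by (intro reflected unit_left[OF c m4]) auto
    next
      case 3
      \<comment> \<open>\<open>unit_flat\<close> asks for the bound on \<open>hi\<close>, not on the
        entries; lowering \<open>hi\<close> only strengthens the claim.\<close>
      let ?h = "min hi ((real m - 1) / m)"
      have "g (sum_mset M / m) \<le> (\<Sum>x\<in>#M. g x) / m + (?h - lo) + c / m"
        using 3 M m by (intro unit_flat[OF c m4]) (auto simp: field_simps min_def)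
      thus ?thesis by linarith
    next
      case 4
      let ?h = "min (1 - lo) ((real m - 1) / m)"
      have "g (sum_mset ?R / m) \<le> (\<Sum>x\<in>#?R. g x) / m + (?h - (1 - hi)) + c / m"
        using 4 M m R(6) by (intro unit_flat[OF c m4]) (auto simp: field_simps min_def)
      thus ?thesis by (intro reflected) linarith
    next
      case 5
      \<comment> \<open>For \<open>m = 2\<close> the range strictly between 1 and
        \<open>m - 1\<close> is empty.\<close>
      have "m = 3 \<or> m = 4" using 5(1,2) m m4 by auto
      thus ?thesis
      proof
        assume m3: "m = 3"
        then obtain x y z where "M = {#x, y, z#}" "x \<le> y" "y \<le> z"
          using sorted_multiset_3 M(1) by metis
        thus ?thesis
          using 5 m3 M by (intro unit_straddle_3[OF c m4, of M lo hi x y z]) auto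
      next
        assume m4': "m = 4"
        then obtain x y z w where "M = {#x, y, z, w#}" "x \<le> y" "y \<le> z" "z \<le> w"
          using sorted_multiset_4 M(1) by metis
        thus ?thesis
          using 5 m4' M by (intro unit_straddle_4[OF c m4, of M lo hi x y z w]) auto
      qed
    qed
  qed
qed (use c in simp)

text \<open>Any bound \<open>B\<close> of a nonnegative g is an admissible initial error;
  contraction turns it into \<open>B / m ^ n\<close>, which tends to 0.\<close>

lemma jensen_0:
  assumes m4: "m \<le> 4" and B: "\<And>x. 0 \<le> g x" "\<And>x. g x \<le> B"
  shows "jensen 0"
proof -
  have B0: "0 \<le> B" using B[of 0] by linarith
  have step: "jensen (B / m ^ n)" for n
  proof (induction n)
    case 0
    have "g (sum_mset M / m) \<le> (\<Sum>x\<in>#M. g x) / m + (hi - lo) + B"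
      if "size M = m" "\<forall>x\<in>#M. lo \<le> x \<and> x \<le> hi" for M lo hi
    proof -
      have "M \<noteq> {#}" using that m by auto
      then obtain x where "x \<in># M" by blast
      moreover have "0 \<le> (\<Sum>x\<in>#M. g x) / m"
        using B(1) sum_mset_mono[of M "\<lambda>_. 0" g] by simp
      ultimately show ?thesis using B(2)[of "sum_mset M / m"] that(2) by force
    qed
    thus ?case by (simp add: jensen_def)
  next
    case (Suc n)
    thus ?case using jensen_contract[of "B / m ^ n"] m4 B0 by (simp add: mult.commute)
  qed
  show ?thesis
    unfolding jensen_def
  proof (intro allI impI)
    fix M and lo hi :: real assume "size M = m" "\<forall>x\<in>#M. lo \<le> x \<and> x \<le> hi"
    hence "g (sum_mset M / m) \<le> (\<Sum>x\<in>#M. g x) / m + (hi - lo) + B * (1 / m) ^ n" for n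
      using jensenD[OF step[of n], of M lo hi] by (simp add: power_one_over)
    moreover have "(\<lambda>n. (\<Sum>x\<in>#M. g x) / m + (hi - lo) + B * (1 / m) ^ n)
        \<longlonglongrightarrow> (\<Sum>x\<in>#M. g x) / m + (hi - lo) + B * 0"
      using m by (intro tendsto_intros LIMSEQ_power_zero) auto
    ultimately show "g (sum_mset M / m) \<le> (\<Sum>x\<in>#M. g x) / m + (hi - lo) + 0"
      by (intro LIMSEQ_le_const[of _ _ "g (sum_mset M / m)"]) auto
  qed
qed

end

section \<open>From multisets back to indexed tuples\<close>

lemma self_similar_takagi: "m \<ge> 2 \<Longrightarrow> self_similar m (takagi m)"
  by unfold_locales
     (simp_all add: takagi_minus takagi_add_int takagi_add_le takagi_0 takagi_rec[symmetric])

lemma takagi_in_F_class: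
  assumes m2: "m \<ge> 2" and m4: "m \<le> 4"
  shows "takagi m \<in> F_class m"
proof -
  interpret self_similar m "takagi m" by (rule self_similar_takagi[OF m2])
  have j: "jensen 0" using m4 takagi_bounds[OF m2] by (rule jensen_0)
  have "takagi m ((\<Sum>i=1..m. x i) / m) \<le> (\<Sum>i=1..m. takagi m (x i)) / m + (x m - x 1)"
    if "Min (x ` {1..m}) = x 1" "Max (x ` {1..m}) = x m" for x :: "nat \<Rightarrow> real"
  proof -
    let ?M = "image_mset x (mset_set {1..m})"
    have "x 1 \<le> x i" "x i \<le> x m" if "i \<in> {1..m}" for i
      unfolding \<open>Min _ = _\<close>[symmetric] \<open>Max _ = _\<close>[symmetric] using that by auto
    hence "takagi m (sum_mset ?M / m) \<le> (\<Sum>y\<in>#?M. takagi m y) / m + (x m - x 1) + 0"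
      by (intro jensenD[OF j]) auto
    thus ?thesis
      by (simp add: image_mset.compositionality o_def sum_unfold_sum_mset)
  qed
  moreover have "takagi m 0 = 0" "takagi m 1 = 0"
    using takagi_int[OF m2, of 0] takagi_int[OF m2, of 1] by simp_all
  ultimately show ?thesis
    using takagi_bounds(2)[OF m2] by (auto simp: F_class_def relaxed_convex_def bdd_above_def)
qed

theorem theorem7:
  fixes m :: nat
  assumes "m \<ge> 2"
  shows "(\<forall>x\<in>{0..1}. F_max m x \<le> real m * omega m x) \<and>
         ((\<forall>x\<in>{0..1}. F_max m x = real m * omega m x) \<longleftrightarrow> m \<in> {2, 3, 4})"
proof -
  have "F_max m x = takagi m x" if "m \<in> {2, 3, 4}" "x \<in> {0..1}" for x
    using that F_max_le_takagi[of m x] F_class_le_F_max[OF takagi_in_F_class, of m x] by auto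
  moreover have "m \<in> {2, 3, 4}" if "\<forall>x\<in>{0..1}. F_max m x = takagi m x"
    using that takagi_not_convex[of m] assms by force
  moreover have "\<forall>x\<in>{0..1}. F_max m x \<le> takagi m x"
    using F_max_le_takagi[OF assms] by auto
  ultimately show ?thesis unfolding takagi_def by blast
qed

end
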